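(* Let $\alpha$ and $\lambda$ be nonzero complex numbers, and $n,k\ge 0$ integers. Then $$y_{1,\alpha}^{*}(n,k;\lambda)=\frac{1}{k!}\sum_{j=0}^{k}\binom{k}{j}\,j!\,\lambda^{j}\,(\lambda+1)_{k-j,\alpha}\,S_{2}^{*}\!\left(n,j\,\Big|\,\frac{\alpha}{\lambda}\right).$$
   Context: For an element $x$ of a commutative $\mathbb{C}$-algebra (e.g. a number or a formal power series in $t$) and a number $\beta$, the degenerate falling factorial is $(x)_{0,\beta}=1$ and $(x)_{n,\beta}=x(x-\beta)(x-2\beta)\cdots(x-(n-1)\beta)$ for $n\ge 1$. The new type degenerate Simsek numbers $y_{1,\alpha}^{*}(n,k;\lambda)$ are defined by $$\frac{(\lambda e^t+1)_{k,\alpha}}{k!}=\sum_{n=0}^{\infty}y_{1,\alpha}^{*}(n,k;\lambda)\frac{t^n}{n!}.$$ The new type degenerate Stirling numbers of the second kind $S_2^{*}(n,k|\beta)$ are defined, for all integers $n,k\ge0$, by $$\frac{1}{k!}(e^t-1)_{k,\beta}=\sum_{n=0}^{\infty}S_2^{*}(n,k|\beta)\frac{t^n}{n!}$$ (in particular $S_2^{*}(0,0|\beta)=1$ and $S_2^{*}(n,0|\beta)=0$ for $n\ge1$). *)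

theory Defs
  imports Complex_Main "HOL-Computational_Algebra.Formal_Power_Series"
begin

text \<open>
  \<open>degen_ffact x \<beta> n\<close> is $(x)_{n,\beta}$. The step \<open>\<beta>\<close> lives in the same ring as \<open>x\<close>; for a power
  series \<open>x\<close> over the complex numbers, a scalar step is embedded with \<^const>\<open>fps_const\<close>.
\<close>
definition degen_ffact :: "'a::comm_ring_1 \<Rightarrow> 'a \<Rightarrow> nat \<Rightarrow> 'a" where
  "degen_ffact x \<beta> n = (\<Prod>i<n. x - of_nat i * \<beta>)"

definition simsek_gf :: "complex \<Rightarrow> complex \<Rightarrow> nat \<Rightarrow> complex fps" where
  "simsek_gf \<alpha> lam k =
     fps_const (1 / fact k) * degen_ffact (fps_const lam * fps_exp 1 + 1) (fps_const \<alpha>) k"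

text \<open>The factor \<open>fact n\<close> turns an ordinary coefficient into an exponential one.\<close>
definition simsek_number :: "complex \<Rightarrow> nat \<Rightarrow> nat \<Rightarrow> complex \<Rightarrow> complex" where
  "simsek_number \<alpha> n k lam = fact n * fps_nth (simsek_gf \<alpha> lam k) n"

definition degen_stirling2_gf :: "complex \<Rightarrow> nat \<Rightarrow> complex fps" where
  "degen_stirling2_gf \<beta> k =
     fps_const (1 / fact k) * degen_ffact (fps_exp 1 - 1) (fps_const \<beta>) k"

definition degen_stirling2 :: "nat \<Rightarrow> nat \<Rightarrow> complex \<Rightarrow> complex" where
  "degen_stirling2 n k \<beta> = fact n * fps_nth (degen_stirling2_gf \<beta> k) n"

lemma simsek_gf_eq: "simsek_gf \<alpha> lam k = Abs_fps (\<lambda>n. simsek_number \<alpha> n k lam / fact n)"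
  by (rule fps_ext) (simp add: simsek_number_def)

lemma degen_stirling2_gf_eq: "degen_stirling2_gf \<beta> k = Abs_fps (\<lambda>n. degen_stirling2 n k \<beta> / fact n)"
  by (rule fps_ext) (simp add: degen_stirling2_def)

end

theory Submission
  imports Defs
begin

text \<open>
  Degenerate falling factorials satisfy a Vandermonde convolution and are homogeneous in \<open>(x, \<beta>)\<close>.
  Apply the convolution to $\lambda e^t + 1 = \lambda (e^t - 1) + (\lambda + 1)$ and pull $\lambda^j$
  out of $(\lambda (e^t - 1))_{j,\alpha}$, which leaves the step $\alpha/\lambda$.
\<close>

lemma degen_ffact_Suc: "degen_ffact x \<beta> (Suc n) = degen_ffact x \<beta> n * (x - of_nat n * \<beta>)"
  by (simp add: degen_ffact_def)

text \<open>By induction: in the summand for \<open>j\<close> the new factor splits as (x -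
  j\<beta>) + (y - (k - j)\<beta>), and each part extends one of the two factorials by its next
  factor. Pascal's rule recombines the terms.\<close>

lemma degen_ffact_add:
  "degen_ffact (x + y) \<beta> k =
    (\<Sum>j\<le>k. of_nat (k choose j) * degen_ffact x \<beta> j * degen_ffact y \<beta> (k - j))"
proof (induction k)
  case 0
  then show ?case by (simp add: degen_ffact_def)
next
  case (Suc k)
  let ?F = "degen_ffact x \<beta>" and ?G = "degen_ffact y \<beta>"
  have "degen_ffact (x + y) \<beta> (Suc k) =
      (\<Sum>j\<le>k. of_nat (k choose j) * ?F j * ?G (k - j) * (x + y - of_nat k * \<beta>))"
    by (simp add: degen_ffact_Suc Suc.IH sum_distrib_right)
  also have "\<dots> = (\<Sum>j\<le>k. of_nat (k choose j) * ?F (Suc j) * ?G (k - j)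
      + of_nat (k choose j) * ?F j * ?G (Suc k - j))"
  proof (rule sum.cong)
    fix j assume "j \<in> {..k}"
    then have "Suc k - j = Suc (k - j)" and "of_nat k = (of_nat j + of_nat (k - j) :: 'a)"
      by (auto simp: Suc_diff_le simp flip: of_nat_add)
    then show "of_nat (k choose j) * ?F j * ?G (k - j) * (x + y - of_nat k * \<beta>) =
        of_nat (k choose j) * ?F (Suc j) * ?G (k - j) + of_nat (k choose j) * ?F j * ?G (Suc k - j)"
      by (simp add: degen_ffact_Suc algebra_simps)
  qed simp
  \<comment> \<open>The second sum may run up to \<open>Suc k\<close> because
    \<open>k choose Suc k\<close> is 0.\<close>
  also have "\<dots> = (\<Sum>j\<le>k. of_nat (k choose j) * ?F (Suc j) * ?G (k - j))
      + (\<Sum>j\<le>Suc k. of_nat (k choose j) * ?F j * ?G (Suc k - j))"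
    by (simp add: sum.distrib binomial_eq_0)
  \<comment> \<open>Splitting off the term \<open>j = 0\<close> aligns the indices for Pascal's
    rule.\<close>
  also have "\<dots> = (\<Sum>j\<le>Suc k. of_nat (Suc k choose j) * ?F j * ?G (Suc k - j))"
    by (simp add: sum.atMost_Suc_shift sum.distrib algebra_simps del: sum.atMost_Suc)
  finally show ?case .
qed

text \<open>Each of the \<open>n\<close> factors contributes one \<open>c\<close>. Scaling the step
  by \<open>c\<close> avoids division, so the identity applies to power series.\<close>

lemma degen_ffact_mult: "degen_ffact (c * x) (c * \<beta>) n = c ^ n * degen_ffact x \<beta> n"
  by (induction n) (simp_all add: degen_ffact_Suc degen_ffact_def[of _ _ 0] algebra_simps)

lemma degen_ffact_fps_const:
  "degen_ffact (fps_const a) (fps_const b) n = fps_const (degen_ffact a b n)"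
  by (induction n)
    (simp_all add: degen_ffact_Suc degen_ffact_def[of _ _ 0] fps_of_nat[symmetric])

theorem theorem2p8:
  fixes \<alpha> lam :: complex and n k :: nat
  assumes "\<alpha> \<noteq> 0" and "lam \<noteq> 0"
  shows "simsek_number \<alpha> n k lam =
    1 / fact k * (\<Sum>j=0..k. of_nat (k choose j) * fact j * lam ^ j
      * degen_ffact (lam + 1) \<alpha> (k - j) * degen_stirling2 n j (\<alpha> / lam))"
proof -
  let ?E = "fps_exp 1 - 1 :: complex fps"
  have split: "fps_const lam * fps_exp 1 + 1 = fps_const lam * ?E + fps_const (lam + 1)"
    by (simp add: algebra_simps flip: fps_const_add)
  have scale: "degen_ffact (fps_const lam * ?E) (fps_const \<alpha>) j =
      fps_const (lam ^ j * fact j) * degen_stirling2_gf (\<alpha> / lam) j" for j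
  proof -
    \<comment> \<open>The step must be a multiple of \<open>lam\<close> for homogeneity to apply;
      this uses \<open>lam \<noteq> 0\<close>.\<close>
    have "fps_const \<alpha> = fps_const lam * fps_const (\<alpha> / lam)"
      using assms(2) by simp
    then have "degen_ffact (fps_const lam * ?E) (fps_const \<alpha>) j =
        fps_const (lam ^ j) * degen_ffact ?E (fps_const (\<alpha> / lam)) j"
      by (simp only: degen_ffact_mult fps_const_power)
    \<comment> \<open>Undoing the normalisation 1/j! of the Stirling series produces the
      \<open>fact j\<close> of the claim.\<close>
    moreover have "degen_ffact ?E (fps_const (\<alpha> / lam)) j =
        fps_const (fact j) * degen_stirling2_gf (\<alpha> / lam) j"
      by (simp add: degen_stirling2_gf_def flip: mult.assoc)
    ultimately show ?thesis
      by (simp add: mult.assoc flip: fps_const_mult)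
  qed
  have "simsek_gf \<alpha> lam k = fps_const (1 / fact k) * (\<Sum>j\<le>k.
      fps_const (of_nat (k choose j) * (lam ^ j * fact j) * degen_ffact (lam + 1) \<alpha> (k - j))
        * degen_stirling2_gf (\<alpha> / lam) j)"
    unfolding simsek_gf_def split degen_ffact_add scale degen_ffact_fps_const
    by (simp add: mult_ac fps_of_nat[symmetric] flip: fps_const_mult)
  \<comment> \<open>All weights are constant in t, so comparing coefficients of t^n and multiplying
    by n! gives the formula.\<close>
  then show ?thesis
    by (simp add: simsek_number_def degen_stirling2_def fps_sum_nth sum_distrib_left atMost_atLeast0 mult_ac)
qed

end
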